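(* Let $\Omega\subseteq\mathbb{R}^d$ be a domain and let $H_1,\dots,H_n$ be admissible reproducing kernel Hilbert spaces of vector fields on $\Omega$. Let $H=H_1+\dots+H_n$ be endowed with the norm $$\|v\|_H^2=\inf\Big\{\sum_{i=1}^n\|v_i\|_{H_i}^2 \;\Big|\; v_i\in H_i,\ \sum_{i=1}^n v_i=v\Big\}.$$ For $(v_i)_{i=1\dots n}\in L^2([0,1],\bigoplus_{i=1}^n H_i)$ put $$\mathcal{E}(v_1,\dots,v_n)=\frac12\int_0^1\sum_{i=1}^n\|v_i(t)\|_{H_i}^2\,\mathrm{d}t+d^2(\varphi(1).I_0,I_{\mathrm{target}}),$$ where $\varphi(t)$ is the flow generated by $v(t)=\sum_{i=1}^n v_i(t)$. Then the minimisation of $\mathcal{E}$ reduces to the minimisation of $$\mathcal{F}(v)=\frac12\int_0^1\|v(t)\|_H^2\,\mathrm{d}t+d^2(\varphi(1).I_0,I_{\mathrm{target}}),$$ where $v\in L^2([0,1],H)$ and $\varphi(t)$ is the flow of $v(t)$.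
   Context: An admissible reproducing kernel Hilbert space $H$ of vector fields on $\Omega$ is a Hilbert space of $C^1$ vector fields $\Omega\to\mathbb{R}^d$ for which there is a constant $M>0$ with $\|v\|_{1,\infty}\le M\|v\|_H$ for all $v\in H$. All vector fields are assumed to vanish on the boundary of $\Omega$, so that flows are well defined. The flow $\varphi(t)$ of a time-dependent vector field $v(t)$ is the solution of $\partial_t\varphi(t)=v(t)\circ\varphi(t)$, $\varphi(0)=\mathrm{Id}$. The group of diffeomorphisms $\varphi(1)$ obtained in this way acts on a set $Q$ of objects (for example images), the action being denoted $\varphi.I$; $d$ is a distance on $Q$, and $I_0,I_{\mathrm{target}}\in Q$ are fixed. With the norm above, $H$ is a Hilbert space. The direct sum $\bigoplus_{i=1}^n H_i$ carries the norm $\left(\sum_i\|v_i\|_{H_i}^2\right)^{1/2}$. *)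

theory Defs
  imports
    "HOL-Analysis.Analysis"
    "HOL-Algebra.Group_Action"
    "HOL-Library.Function_Algebras"
begin

text \<open>
  The spaces \<open>H\<^sub>1, \<dots>, H\<^sub>n\<close> are different subspaces of one vector space of functions, each with
  its own norm.  They are therefore records (carrier, norm) rather than types, and functions with
  values in a vector space get their pointwise vector space structure.
\<close>

instantiation "fun" :: (type, real_vector) real_vector
begin

definition scaleR_fun :: "real \<Rightarrow> ('a \<Rightarrow> 'b) \<Rightarrow> 'a \<Rightarrow> 'b"
  where "scaleR_fun c f = (\<lambda>x. c *\<^sub>R f x)"

instance
  by standard (simp_all add: scaleR_fun_def plus_fun_def fun_eq_iff algebra_simps)

end

record 'x nspace = "'x partial_object" +
  nrm :: "'x \<Rightarrow> real"

definition inner_product_on :: "'x::real_vector set \<Rightarrow> ('x \<Rightarrow> 'x \<Rightarrow> real) \<Rightarrow> bool" where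
  "inner_product_on V ip \<longleftrightarrow>
     subspace V \<and>
     (\<forall>u\<in>V. \<forall>v\<in>V. ip u v = ip v u) \<and>
     (\<forall>u\<in>V. \<forall>v\<in>V. \<forall>w\<in>V. ip (u + v) w = ip u w + ip v w) \<and>
     (\<forall>c. \<forall>u\<in>V. \<forall>v\<in>V. ip (c *\<^sub>R u) v = c * ip u v) \<and>
     (\<forall>u\<in>V. 0 \<le> ip u u) \<and>
     (\<forall>u\<in>V. ip u u = 0 \<longrightarrow> u = 0)"

text \<open>The inner product is not part of the record: it is determined by the norm (polarization).\<close>

definition hilbert_space :: "'x::real_vector nspace \<Rightarrow> bool" where
  "hilbert_space X \<longleftrightarrow>
     (\<exists>ip. inner_product_on (carrier X) ip \<and> (\<forall>u\<in>carrier X. nrm X u = sqrt (ip u u))) \<and>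
     (\<forall>s::nat \<Rightarrow> 'x. (\<forall>k. s k \<in> carrier X) \<longrightarrow>
        (\<forall>e>0. \<exists>N. \<forall>j\<ge>N. \<forall>k\<ge>N. nrm X (s j - s k) < e) \<longrightarrow>
        (\<exists>l\<in>carrier X. (\<lambda>k. nrm X (s k - l)) \<longlonglongrightarrow> 0))"

text \<open>The direct sum over \<open>i = 1, \<dots>, n\<close>; families are set to \<open>0\<close> at all other indices.\<close>

definition direct_sum :: "nat \<Rightarrow> (nat \<Rightarrow> 'x::real_vector nspace) \<Rightarrow> (nat \<Rightarrow> 'x) nspace" where
  "direct_sum n H =
     \<lparr>carrier = {u. (\<forall>i\<in>{1..n}. u i \<in> carrier (H i)) \<and> (\<forall>i. i \<notin> {1..n} \<longrightarrow> u i = 0)},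
      nrm = (\<lambda>u. sqrt (\<Sum>i=1..n. (nrm (H i) (u i))\<^sup>2))\<rparr>"

definition sum_space :: "nat \<Rightarrow> (nat \<Rightarrow> 'x::real_vector nspace) \<Rightarrow> 'x nspace" where
  "sum_space n H =
     \<lparr>carrier = {\<Sum>i=1..n. u i | u. \<forall>i\<in>{1..n}. u i \<in> carrier (H i)},
      nrm = (\<lambda>v. sqrt (Inf {(\<Sum>i=1..n. (nrm (H i) (u i))\<^sup>2) | u.
                             (\<forall>i\<in>{1..n}. u i \<in> carrier (H i)) \<and> (\<Sum>i=1..n. u i) = v}))\<rparr>"

text \<open>
  Strong (Bochner) measurability: a.e. limit, in the norm of \<open>X\<close>, of \<open>X\<close>-valued simple functions.
\<close>

definition strongly_measurable :: "'x::real_vector nspace \<Rightarrow> (real \<Rightarrow> 'x) \<Rightarrow> bool" where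
  "strongly_measurable X f \<longleftrightarrow>
     (\<exists>s::nat \<Rightarrow> real \<Rightarrow> 'x.
        (\<forall>k. simple_function (lebesgue_on {0..1}) (s k)) \<and>
        (\<forall>k. \<forall>t\<in>{0..1}. s k t \<in> carrier X) \<and>
        (AE t in lebesgue_on {0..1}. (\<lambda>k. nrm X (s k t - f t)) \<longlonglongrightarrow> 0))"

text \<open>
  The elements are functions, not classes modulo null sets; values outside \<open>[0,1]\<close> are irrelevant.
\<close>

definition L2 :: "'x::real_vector nspace \<Rightarrow> (real \<Rightarrow> 'x) set" where
  "L2 X = {f. (\<forall>t\<in>{0..1}. f t \<in> carrier X) \<and> strongly_measurable X f \<and>
              integrable (lebesgue_on {0..1}) (\<lambda>t. (nrm X (f t))\<^sup>2)}"

type_synonym 'd vfield = "real^'d \<Rightarrow> real^'d"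

definition C1_on :: "(real^'d) set \<Rightarrow> 'd::finite vfield \<Rightarrow> bool" where
  "C1_on \<Omega> v \<longleftrightarrow>
     (\<exists>D :: real^'d \<Rightarrow> (real^'d) \<Rightarrow>\<^sub>L (real^'d).
        (\<forall>x\<in>\<Omega>. (v has_derivative blinfun_apply (D x)) (at x)) \<and> continuous_on \<Omega> D)"

text \<open>
  A vector field on \<open>\<Omega>\<close> that vanishes on the boundary is represented by its extension by zero
  to the whole space.
\<close>

definition vanishes_at_boundary :: "(real^'d) set \<Rightarrow> 'd::finite vfield \<Rightarrow> bool" where
  "vanishes_at_boundary \<Omega> v \<longleftrightarrow> continuous_on (closure \<Omega>) v \<and> (\<forall>x. x \<notin> \<Omega> \<longrightarrow> v x = 0)"

text \<open>Extended-valued, since a supremum of an unbounded set of reals would be unspecified.\<close>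

definition norm_1_inf :: "(real^'d) set \<Rightarrow> 'd::finite vfield \<Rightarrow> ennreal" where
  "norm_1_inf \<Omega> v =
     (SUP x\<in>\<Omega>. ennreal (norm (v x))) +
     (SUP x\<in>\<Omega>. ennreal (onorm (frechet_derivative v (at x))))"

definition admissible :: "(real^'d) set \<Rightarrow> 'd::finite vfield nspace \<Rightarrow> bool" where
  "admissible \<Omega> H \<longleftrightarrow>
     hilbert_space H \<and>
     (\<forall>v\<in>carrier H. C1_on \<Omega> v \<and> vanishes_at_boundary \<Omega> v) \<and>
     (\<exists>M>0. \<forall>v\<in>carrier H. norm_1_inf \<Omega> v \<le> ennreal (M * nrm H v))"

text \<open>
  The equation \<open>\<partial>\<^sub>t \<phi>(t) = v(t) \<circ> \<phi>(t)\<close>, \<open>\<phi>(0) = Id\<close>, in the Caratheodory sense, as \<open>v\<close> is only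
  square integrable in time.  Since the fields are zero off \<open>\<Omega>\<close>, the points off \<open>\<Omega>\<close> stay fixed,
  so each \<open>\<phi>(t)\<close> is a map of \<open>\<Omega>\<close> to itself extended by the identity.
\<close>

definition is_flow :: "(real \<Rightarrow> 'd::finite vfield) \<Rightarrow> (real \<Rightarrow> 'd vfield) \<Rightarrow> bool" where
  "is_flow v \<phi> \<longleftrightarrow>
     \<phi> 0 = id \<and>
     (\<forall>x. \<forall>t\<in>{0..1}. ((\<lambda>s. v s (\<phi> s x)) has_integral (\<phi> t x - x)) {0..t})"

text \<open>
  For \<open>v\<close> in \<open>L\<^sup>2([0,1], H)\<close> with \<open>H\<close> admissible the flow exists and is unique for times in
  \<open>[0,1]\<close>; the choice only concerns other times.
\<close>

definition flow :: "(real \<Rightarrow> 'd::finite vfield) \<Rightarrow> real \<Rightarrow> 'd vfield" where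
  "flow v = (SOME \<phi>. is_flow v \<phi>)"

definition diffeo_group :: "'d::finite vfield nspace \<Rightarrow> 'd vfield monoid" where
  "diffeo_group H = \<lparr>carrier = {flow v 1 | v. v \<in> L2 H}, mult = (\<circ>), one = id\<rparr>"

definition energy_E ::
  "nat \<Rightarrow> (nat \<Rightarrow> 'd::finite vfield nspace) \<Rightarrow> ('d vfield \<Rightarrow> 'q \<Rightarrow> 'q) \<Rightarrow> ('q \<Rightarrow> 'q \<Rightarrow> real) \<Rightarrow>
   'q \<Rightarrow> 'q \<Rightarrow> (real \<Rightarrow> nat \<Rightarrow> 'd vfield) \<Rightarrow> real" where
  "energy_E n H act d I0 I1 v =
     1/2 * (LINT t|lebesgue_on {0..1}. (\<Sum>i=1..n. (nrm (H i) (v t i))\<^sup>2)) +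
     (d (act (flow (\<lambda>t. \<Sum>i=1..n. v t i) 1) I0) I1)\<^sup>2"

definition energy_F ::
  "'d::finite vfield nspace \<Rightarrow> ('d vfield \<Rightarrow> 'q \<Rightarrow> 'q) \<Rightarrow> ('q \<Rightarrow> 'q \<Rightarrow> real) \<Rightarrow>
   'q \<Rightarrow> 'q \<Rightarrow> (real \<Rightarrow> 'd vfield) \<Rightarrow> real" where
  "energy_F H act d I0 I1 v =
     1/2 * (LINT t|lebesgue_on {0..1}. (nrm H (v t))\<^sup>2) + (d (act (flow v 1) I0) I1)\<^sup>2"

end

(*
  Summation is a bounded linear map S from the Hilbert direct sum X of the H_i onto H.  Convergence
  in H_i implies pointwise convergence, so ker S is closed, and each v in H has a unique preimage
  P v orthogonal to ker S.  It has minimal norm among the preimages, hence P is a linear isometry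
  from H into X, and v(t) = P (w(t)) is a strongly measurable decomposition of w with equal energy.
*)
theory Submission
  imports Defs
begin

text \<open>The matching term depends on a family only through its sum, so everything rests on the
  kinetic term. The obstacle there is measurability in time: an almost optimal decomposition chosen
  for each \<open>t\<close> separately need not depend measurably on \<open>t\<close>, and it loses
  a little energy. A single map \<open>P\<close>, applied to all values \<open>w t\<close>, avoids
  both losses. Composition with any map keeps a function simple, and an additive isometry keeps norm
  limits, so strong measurability survives. Since the infimum defining the norm of \<open>H\<close>
  is attained at \<open>P v\<close>, the energies agree exactly. The same isometry carries the norm
  inequalities of the direct sum over to \<open>H\<close>. Admissibility supplies the pointwise
  bounds: the supremum part of \<open>norm_1_inf\<close> on \<Omega>, and the vanishing of the
  fields off \<Omega>.\<close>

section \<open>Inner product geometry on records, up to orthogonal projection\<close>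

locale inner_product_nspace =
  fixes X :: "'x::real_vector nspace" and ip :: "'x \<Rightarrow> 'x \<Rightarrow> real"
  assumes ip: "inner_product_on (carrier X) ip"
    and nrm_eq: "u \<in> carrier X \<Longrightarrow> nrm X u = sqrt (ip u u)"
begin

lemma subspace_carrier: "subspace (carrier X)"
  using ip by (simp add: inner_product_on_def)

lemmas carrier_closed [simp] =
  subspace_0 [OF subspace_carrier] subspace_add [OF subspace_carrier]
  subspace_diff [OF subspace_carrier] subspace_scale [OF subspace_carrier]

lemma ip_commute: "u \<in> carrier X \<Longrightarrow> v \<in> carrier X \<Longrightarrow> ip u v = ip v u"
  using ip by (simp add: inner_product_on_def)

lemma ip_add_left:
  "u \<in> carrier X \<Longrightarrow> v \<in> carrier X \<Longrightarrow> w \<in> carrier X \<Longrightarrow> ip (u + v) w = ip u w + ip v w"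
  using ip [unfolded inner_product_on_def, THEN conjunct2, THEN conjunct2, THEN conjunct1] by metis

lemma ip_scale_left: "u \<in> carrier X \<Longrightarrow> v \<in> carrier X \<Longrightarrow> ip (c *\<^sub>R u) v = c * ip u v"
  using ip [unfolded inner_product_on_def, THEN conjunct2, THEN conjunct2, THEN conjunct2, THEN conjunct1] by metis

lemma ip_nonneg: "u \<in> carrier X \<Longrightarrow> 0 \<le> ip u u"
  using ip by (simp add: inner_product_on_def)

lemma ip_eq_0: "u \<in> carrier X \<Longrightarrow> ip u u = 0 \<Longrightarrow> u = 0"
  using ip by (simp add: inner_product_on_def)

lemma ip_diff_left:
  assumes "u \<in> carrier X" "v \<in> carrier X" "w \<in> carrier X"
  shows "ip (u - v) w = ip u w - ip v w"
  using ip_add_left [of "u - v" v w] assms by simp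

lemma ip_add_right:
  "u \<in> carrier X \<Longrightarrow> v \<in> carrier X \<Longrightarrow> w \<in> carrier X \<Longrightarrow> ip w (u + v) = ip w u + ip w v"
  by (simp add: ip_commute [of w] ip_add_left)

lemma ip_diff_right:
  "u \<in> carrier X \<Longrightarrow> v \<in> carrier X \<Longrightarrow> w \<in> carrier X \<Longrightarrow> ip w (u - v) = ip w u - ip w v"
  by (simp add: ip_commute [of w] ip_diff_left)

lemma ip_scale_right: "u \<in> carrier X \<Longrightarrow> v \<in> carrier X \<Longrightarrow> ip v (c *\<^sub>R u) = c * ip v u"
  by (simp add: ip_commute [of v] ip_scale_left)

lemmas ip_expand = ip_add_left ip_diff_left ip_scale_left ip_add_right ip_diff_right ip_scale_right

lemma nrm_nonneg: "u \<in> carrier X \<Longrightarrow> 0 \<le> nrm X u"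
  by (simp add: nrm_eq ip_nonneg)

lemma nrm_power2: "u \<in> carrier X \<Longrightarrow> (nrm X u)\<^sup>2 = ip u u"
  by (simp add: nrm_eq ip_nonneg)

lemma nrm_0: "nrm X 0 = 0"
  using ip_scale_left [of 0 0 0] by (simp add: nrm_eq)

lemma nrm_minus_commute: "u \<in> carrier X \<Longrightarrow> v \<in> carrier X \<Longrightarrow> nrm X (u - v) = nrm X (v - u)"
  by (simp add: nrm_eq ip_expand)

lemma Cauchy_Schwarz:
  assumes u: "u \<in> carrier X" and v: "v \<in> carrier X"
  shows "ip u v \<le> nrm X u * nrm X v"
proof (cases "v = 0")
  case True
  then show ?thesis
    using ip_scale_right [of 0 u 0] u by (simp add: nrm_0)
next
  case False
  then have pos: "ip v v > 0"
    using ip_nonneg ip_eq_0 v by (metis less_eq_real_def)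
  \<comment> \<open>\<open>c *\<^sub>R v\<close> is the orthogonal projection of \<open>u\<close>
    onto the line through \<open>v\<close>; nonnegativity of the squared residual is then the
    squared inequality.\<close>
  define c where "c = ip u v / ip v v"
  have "0 \<le> ip (u - c *\<^sub>R v) (u - c *\<^sub>R v)"
    using u v by (intro ip_nonneg) simp
  also have "\<dots> = ip u u - (ip u v)\<^sup>2 / ip v v"
    using u v pos ip_commute [OF u v]
    by (simp add: ip_expand c_def field_simps power2_eq_square)
  finally have "(ip u v)\<^sup>2 \<le> ip u u * ip v v"
    using pos by (simp add: field_simps)
  then have "\<bar>ip u v\<bar> \<le> sqrt (ip u u * ip v v)"
    by (simp add: real_le_rsqrt)
  then show ?thesis
    using u v by (simp add: nrm_eq real_sqrt_mult)
qed

lemma nrm_triangle: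
  assumes u: "u \<in> carrier X" and v: "v \<in> carrier X"
  shows "nrm X (u + v) \<le> nrm X u + nrm X v"
proof (rule power2_le_imp_le)
  have "(nrm X (u + v))\<^sup>2 = ip u u + 2 * ip u v + ip v v"
    using u v by (simp add: nrm_power2 ip_expand ip_commute [of v u])
  also have "\<dots> \<le> (nrm X u)\<^sup>2 + 2 * (nrm X u * nrm X v) + (nrm X v)\<^sup>2"
    using Cauchy_Schwarz [OF u v] u v by (simp add: nrm_power2)
  finally show "(nrm X (u + v))\<^sup>2 \<le> (nrm X u + nrm X v)\<^sup>2"
    by (simp add: power2_sum algebra_simps)
qed (simp add: nrm_nonneg u v)

text \<open>This continuity of the norm is what later makes \<open>nrm X (f t)\<close> measurable in
  \<open>t\<close> for strongly measurable \<open>f\<close>.\<close>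

lemma nrm_triangle_reverse:
  assumes u: "u \<in> carrier X" and v: "v \<in> carrier X"
  shows "\<bar>nrm X u - nrm X v\<bar> \<le> nrm X (u - v)"
  using nrm_triangle [of "u - v" v] nrm_triangle [of "v - u" u] nrm_minus_commute [OF u v] u v
  by simp

text \<open>A sequence in \<open>K\<close> minimising the distance to \<open>u\<close> is Cauchy by
  the parallelogram law, and its limit is the foot of the perpendicular. Completeness and closedness
  are phrased by sequences because the norm belongs to a record and gives the type no
  topology.\<close>

lemma orthogonal_projection_exists:
  assumes complete: "\<And>s::nat \<Rightarrow> 'x. (\<forall>k. s k \<in> carrier X) \<Longrightarrow>
        (\<forall>e>0. \<exists>N. \<forall>j\<ge>N. \<forall>k\<ge>N. nrm X (s j - s k) < e) \<Longrightarrow>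
        \<exists>l\<in>carrier X. (\<lambda>k. nrm X (s k - l)) \<longlonglongrightarrow> 0"
    and K: "subspace K" "K \<subseteq> carrier X"
    and closed: "\<And>s l. (\<forall>k::nat. s k \<in> K) \<Longrightarrow> l \<in> carrier X \<Longrightarrow>
        (\<lambda>k. nrm X (s k - l)) \<longlonglongrightarrow> 0 \<Longrightarrow> l \<in> K"
    and u: "u \<in> carrier X"
  obtains p where "p \<in> K" "\<And>z. z \<in> K \<Longrightarrow> ip (u - p) z = 0"
proof -
  have KX [simp]: "z \<in> carrier X" if "z \<in> K" for z
    using that K by blast
  define D where "D = (\<lambda>k. ip (u - k) (u - k)) ` K"
  have D_bdd: "bdd_below D"
    by (rule bdd_belowI [of _ 0]) (auto simp: D_def u ip_nonneg)
  have D_ne: "D \<noteq> {}"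
    using subspace_0 [OF K(1)] by (auto simp: D_def)
  define \<delta> where "\<delta> = Inf D"
  have \<delta>_le: "\<delta> \<le> ip (u - k) (u - k)" if "k \<in> K" for k
    unfolding \<delta>_def using that D_bdd by (intro cInf_lower) (auto simp: D_def)
  have "\<exists>k\<in>K. ip (u - k) (u - k) < \<delta> + e" if "e > 0" for e
  proof -
    have "Inf D < \<delta> + e"
      using that by (simp add: \<delta>_def)
    then show ?thesis
      using D_bdd D_ne by (auto simp: cInf_less_iff D_def)
  qed
  then have "\<forall>m::nat. \<exists>k\<in>K. ip (u - k) (u - k) < \<delta> + 1 / Suc m"
    by simp
  then obtain s where sK: "\<And>m. s m \<in> K"
    and s: "\<And>m::nat. ip (u - s m) (u - s m) < \<delta> + 1 / Suc m"
    by metis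
  have parallelogram: "(nrm X (s j - s k))\<^sup>2 \<le> 2 / Suc j + 2 / Suc k" for j k
  proof -
    \<comment> \<open>The midpoint stays in \<open>K\<close>, so its squared distance to
      \<open>u\<close> is at least \<open>\<delta>\<close>; in the parallelogram law this cancels
      the four copies of \<open>\<delta>\<close> coming from \<open>s j\<close> and
      \<open>s k\<close>.\<close>
    define m where "m = (1/2::real) *\<^sub>R (s j + s k)"
    have "m \<in> K"
      using K(1) sK by (simp add: m_def subspace_add subspace_scale)
    have "(nrm X (s j - s k))\<^sup>2 = 2 * ip (u - s j) (u - s j) + 2 * ip (u - s k) (u - s k)
            - 4 * ip (u - m) (u - m)"
      using sK u
      by (simp add: nrm_power2 ip_expand m_def ip_commute [of "s j" "s k"]
          ip_commute [of "s j" u] ip_commute [of "s k" u] algebra_simps)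
    with s [of j] s [of k] \<delta>_le [OF \<open>m \<in> K\<close>] show ?thesis
      by simp
  qed
  have "\<exists>N. \<forall>j\<ge>N. \<forall>k\<ge>N. nrm X (s j - s k) < e" if "e > 0" for e :: real
  proof -
    \<comment> \<open>With this \<open>N\<close> each of the two terms of
      \<open>parallelogram\<close> is below half of \<open>e\<^sup>2\<close>.\<close>
    obtain N :: nat where N: "4 / e\<^sup>2 < real N"
      using reals_Archimedean2 by blast
    have small: "2 / Suc j < e\<^sup>2 / 2" if "j \<ge> N" for j
    proof -
      have "4 / e\<^sup>2 < Suc j"
        using N that by linarith
      then show ?thesis
        using \<open>e > 0\<close> by (simp add: field_simps)
    qed
    have "nrm X (s j - s k) < e" if "j \<ge> N" "k \<ge> N" for j k
    proof (rule power_less_imp_less_base)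
      show "(nrm X (s j - s k))\<^sup>2 < e\<^sup>2"
        using parallelogram [of j k] small [OF that(1)] small [OF that(2)] by linarith
    qed (use \<open>e > 0\<close> in simp)
    then show ?thesis
      by blast
  qed
  then obtain l where l: "l \<in> carrier X" and lim: "(\<lambda>k. nrm X (s k - l)) \<longlonglongrightarrow> 0"
    using complete [of s] sK by auto
  have lK: "l \<in> K"
    using closed [of s l] sK l lim by blast
  have "ip (u - l) (u - l) \<le> \<delta>"
  proof -
    have "nrm X (u - l) \<le> sqrt (\<delta> + 1 / Suc k) + nrm X (s k - l)" for k
    proof -
      have "nrm X (u - l) \<le> nrm X (u - s k) + nrm X (s k - l)"
        using nrm_triangle [of "u - s k" "s k - l"] u l sK by simp
      moreover have "nrm X (u - s k) \<le> sqrt (\<delta> + 1 / Suc k)"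
        using s [of k] u sK by (simp add: nrm_eq)
      ultimately show ?thesis
        by simp
    qed
    moreover have "(\<lambda>k. sqrt (\<delta> + 1 / Suc k) + nrm X (s k - l)) \<longlonglongrightarrow> sqrt (\<delta> + 0) + 0"
      by (intro tendsto_intros lim LIMSEQ_Suc [OF lim_1_over_n])
    ultimately have "nrm X (u - l) \<le> sqrt (\<delta> + 0) + 0"
      by (intro LIMSEQ_le_const) auto
    then show ?thesis
      using u l by (simp add: nrm_eq)
  qed
  then have min: "ip (u - l) (u - l) \<le> ip (u - k) (u - k)" if "k \<in> K" for k
    using \<delta>_le [OF that] by simp
  have "ip (u - l) z = 0" if z: "z \<in> K" for z
  proof (cases "z = 0")
    case True
    then show ?thesis
      using ip_scale_right [of 0 "u - l" 0] u l by simp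
  next
    case False
    then have pos: "ip z z > 0"
      using ip_nonneg [of z] ip_eq_0 [of z] z by (simp add: less_eq_real_def) force
    \<comment> \<open>The step length along \<open>z\<close> that decreases the distance most; since
      \<open>l\<close> is already optimal, the decrease
      \<open>(ip (u - l) z)\<^sup>2 / ip z z\<close> cannot be positive.\<close>
    define c where "c = ip (u - l) z / ip z z"
    have "l + c *\<^sub>R z \<in> K"
      using K(1) lK z by (simp add: subspace_add subspace_scale)
    have "ip (u - l) (u - l) \<le> ip ((u - l) - c *\<^sub>R z) ((u - l) - c *\<^sub>R z)"
      using min [OF \<open>l + c *\<^sub>R z \<in> K\<close>] by (simp add: diff_diff_eq)
    also have "\<dots> = ip (u - l) (u - l) - 2 * c * ip (u - l) z + c * c * ip z z"
      using u l z
      by (simp only: ip_diff_left [of "u - l"] ip_diff_right [of "u - l"] ip_scale_left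
          ip_scale_right ip_commute [of z "u - l"] carrier_closed KX) algebra
    also have "\<dots> = ip (u - l) (u - l) - (ip (u - l) z)\<^sup>2 / ip z z"
      using pos by (simp add: c_def field_simps power2_eq_square)
    finally have "(ip (u - l) z)\<^sup>2 / ip z z \<le> 0"
      by simp
    then show ?thesis
      using pos by (simp add: divide_le_0_iff)
  qed
  with lK that show ?thesis
    by blast
qed

end

section \<open>Minimal-norm preimages under a linear map\<close>

text \<open>The record stores only the norm, so an inner product has to be picked before the locale
  can be interpreted.\<close>

lemma hilbert_space_inner_product_nspace:
  assumes "hilbert_space X"
  obtains ip where "inner_product_nspace X ip"
  using assms by (auto simp: hilbert_space_def inner_product_nspace_def)

lemma hilbert_space_complete:
  assumes "hilbert_space X" "\<forall>k::nat. s k \<in> carrier X"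
    "\<forall>e>0. \<exists>N. \<forall>j\<ge>N. \<forall>k\<ge>N. nrm X (s j - s k) < e"
  shows "\<exists>l\<in>carrier X. (\<lambda>k. nrm X (s k - l)) \<longlonglongrightarrow> 0"
  using assms by (simp add: hilbert_space_def)

text \<open>The lift takes values in the orthogonal complement of the kernel, which makes it additive.\<close>

lemma minimal_norm_lift:
  fixes X :: "'x::real_vector nspace" and S :: "'x \<Rightarrow> 'y::real_vector"
  assumes X: "hilbert_space X" and S: "linear S"
    and closed: "\<And>s l. (\<forall>k::nat. s k \<in> carrier X \<and> S (s k) = 0) \<Longrightarrow> l \<in> carrier X \<Longrightarrow>
        (\<lambda>k. nrm X (s k - l)) \<longlonglongrightarrow> 0 \<Longrightarrow> S l = 0"
  obtains P where "\<And>v. v \<in> S ` carrier X \<Longrightarrow> P v \<in> carrier X"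
    and "\<And>v. v \<in> S ` carrier X \<Longrightarrow> S (P v) = v"
    and "\<And>u. u \<in> carrier X \<Longrightarrow> nrm X (P (S u)) \<le> nrm X u"
    and "\<And>v w. v \<in> S ` carrier X \<Longrightarrow> w \<in> S ` carrier X \<Longrightarrow> P (v - w) = P v - P w"
proof -
  obtain ip where "inner_product_nspace X ip"
    using hilbert_space_inner_product_nspace [OF X] .
  then interpret inner_product_nspace X ip .
  define K where "K = {z \<in> carrier X. S z = 0}"
  have K: "subspace K" "K \<subseteq> carrier X"
    using S by (auto simp: K_def subspace_def linear_0 linear_add linear_scale)
  have KX: "z \<in> carrier X" if "z \<in> K" for z
    using that by (simp add: K_def)
  have K_closed: "l \<in> K"
    if "\<forall>k::nat. s k \<in> K" "l \<in> carrier X" "(\<lambda>k. nrm X (s k - l)) \<longlonglongrightarrow> 0" for s l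
    using closed [of s l] that by (simp add: K_def)
  define lift where "lift v p \<longleftrightarrow> p \<in> carrier X \<and> S p = v \<and> (\<forall>z\<in>K. ip p z = 0)" for v p
  have lift_ex: "\<exists>p. lift v p" if v: "v \<in> S ` carrier X" for v
  proof -
    obtain u where u: "u \<in> carrier X" "v = S u"
      using v by blast
    obtain p where "p \<in> K" "\<And>z. z \<in> K \<Longrightarrow> ip (u - p) z = 0"
      by (rule orthogonal_projection_exists [OF _ K _ u(1)])
        (use hilbert_space_complete [OF X] K_closed in blast)+
    \<comment> \<open>Removing the kernel component \<open>p\<close> of \<open>u\<close> does not
      change the image under \<open>S\<close> and leaves a vector orthogonal to
      \<open>K\<close>.\<close>
    then have "lift v (u - p)"
      using u S by (simp add: lift_def K_def linear_diff)
    then show ?thesis ..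
  qed
  have lift_unique: "p = q" if "lift v p" "lift v q" for v p q
  proof -
    have mem: "p \<in> carrier X" "q \<in> carrier X"
      using that by (simp_all add: lift_def)
    \<comment> \<open>The difference of two lifts lies in \<open>K\<close> and is orthogonal to
      \<open>K\<close>, hence to itself.\<close>
    have "p - q \<in> K"
      using that S by (simp add: lift_def K_def linear_diff)
    then have "ip (p - q) (p - q) = ip p (p - q) - ip q (p - q)"
      using mem by (intro ip_diff_left) simp_all
    also have "\<dots> = 0"
      using that \<open>p - q \<in> K\<close> by (simp add: lift_def)
    finally show ?thesis
      using ip_eq_0 [of "p - q"] mem by simp
  qed
  define P where "P v = (SOME p. lift v p)" for v
  have P: "lift v (P v)" if "v \<in> S ` carrier X" for v
    unfolding P_def by (rule someI_ex [OF lift_ex [OF that]])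
  show ?thesis
  proof
    show "P v \<in> carrier X" "S (P v) = v" if "v \<in> S ` carrier X" for v
      using P [OF that] by (simp_all add: lift_def)
  next
    fix u assume u: "u \<in> carrier X"
    define p where "p = P (S u)"
    have p: "p \<in> carrier X" "S p = S u" "\<And>z. z \<in> K \<Longrightarrow> ip p z = 0"
      using P [of "S u"] u by (auto simp: lift_def p_def)
    then have "u - p \<in> K"
      using u S by (simp add: K_def linear_diff)
    \<comment> \<open>Pythagoras: any preimage \<open>u\<close> of the same vector is the lift
      \<open>p\<close> plus an orthogonal kernel element.\<close>
    have "ip u u = ip (p + (u - p)) (p + (u - p))"
      by simp
    also have "\<dots> = ip p p + 2 * ip p (u - p) + ip (u - p) (u - p)"
      using u p(1) by (simp add: ip_expand ip_commute [of u p])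
    also have "ip p (u - p) = 0"
      using p(3) \<open>u - p \<in> K\<close> by simp
    finally have "ip p p \<le> ip u u"
      using ip_nonneg [of "u - p"] u p(1) by simp
    then show "nrm X (P (S u)) \<le> nrm X u"
      using u p(1) by (simp add: nrm_eq flip: p_def)
  next
    fix v w assume vw: "v \<in> S ` carrier X" "w \<in> S ` carrier X"
    \<comment> \<open>Being a lift is a linear condition, so uniqueness turns the arbitrary choice
      \<open>P\<close> into an additive map.\<close>
    have "lift (v - w) (P v - P w)"
      using P [OF vw(1)] P [OF vw(2)] S KX by (simp add: lift_def linear_diff ip_diff_left)
    moreover have "v - w \<in> S ` carrier X"
      using subspace_diff [OF linear_subspace_image [OF S subspace_carrier]] vw by blast
    ultimately show "P (v - w) = P v - P w"
      using P lift_unique by blast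
  qed
qed

section \<open>Strong measurability and square integrability under contractions\<close>

text \<open>The pointwise \<open>lim\<close> is measurable whether or not the sequence converges,
  and it differs from \<open>f\<close> only on a null set, which Lebesgue measurability
  tolerates.\<close>

lemma borel_measurable_lebesgue_on_AE_limit:
  fixes f :: "'a::euclidean_space \<Rightarrow> 'b::euclidean_space"
  assumes S: "S \<in> sets lebesgue"
    and g: "\<And>k::nat. g k \<in> borel_measurable (lebesgue_on S)"
    and lim: "AE x in lebesgue_on S. (\<lambda>k. g k x) \<longlonglongrightarrow> f x"
  shows "f \<in> borel_measurable (lebesgue_on S)"
proof -
  define h where "h x = lim (\<lambda>k. g k x)" for x
  have h: "h \<in> borel_measurable (lebesgue_on S)"
    unfolding h_def by (intro borel_measurable_lim_metric g)
  have "AE x in lebesgue. x \<in> S \<longrightarrow> (\<lambda>k. g k x) \<longlonglongrightarrow> f x"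
    using lim S by (simp add: AE_restrict_space_iff)
  \<comment> \<open>Extension by zero moves the question from \<open>S\<close> to the whole space,
    where a measurable function may be altered on a null set.\<close>
  then have "AE x in lebesgue. (if x \<in> S then h x else 0) = (if x \<in> S then f x else 0)"
    by eventually_elim (simp add: h_def limI)
  moreover have "(\<lambda>x. if x \<in> S then h x else 0) \<in> borel_measurable lebesgue"
    using h S by (simp add: borel_measurable_if)
  ultimately have "(\<lambda>x. if x \<in> S then f x else 0) \<in> borel_measurable lebesgue"
    by (rule borel_measurable_AE [rotated])
  then show ?thesis
    using S by (simp add: borel_measurable_if)
qed

text \<open>Strong measurability speaks only of approximation by simple functions. Their norms are
  real simple functions, and the reverse triangle inequality makes these converge a.e. to the norm
  of \<open>f\<close>.\<close>

lemma strongly_measurable_nrm: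
  assumes f: "strongly_measurable X f" "\<And>t. t \<in> {0..1} \<Longrightarrow> f t \<in> carrier X"
    and triangle: "\<And>u v. u \<in> carrier X \<Longrightarrow> v \<in> carrier X \<Longrightarrow>
      \<bar>nrm X u - nrm X v\<bar> \<le> nrm X (u - v)"
  shows "(\<lambda>t. nrm X (f t)) \<in> borel_measurable (lebesgue_on {0..1})"
proof -
  obtain s where s: "\<And>k::nat. simple_function (lebesgue_on {0..1}) (s k)"
    and mem: "\<And>k t. t \<in> {0..1} \<Longrightarrow> s k t \<in> carrier X"
    and lim: "AE t in lebesgue_on {0..1}. (\<lambda>k. nrm X (s k t - f t)) \<longlonglongrightarrow> 0"
    using f(1) unfolding strongly_measurable_def by blast
  have "(\<lambda>t. nrm X (s k t)) \<in> borel_measurable (lebesgue_on {0..1})" for k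
    using simple_function_compose [OF s, of "nrm X"]
    by (intro borel_measurable_simple_function) (simp add: o_def)
  moreover have "AE t in lebesgue_on {0..1}. (\<lambda>k. nrm X (s k t)) \<longlonglongrightarrow> nrm X (f t)"
    using lim AE_space
  proof eventually_elim
    case (elim t)
    then have t: "t \<in> {0..1}"
      by simp
    have "(\<lambda>k. nrm X (s k t) - nrm X (f t)) \<longlonglongrightarrow> 0"
      by (rule Lim_null_comparison [OF _ elim(1)])
        (use triangle [OF mem f(2), OF t t] in \<open>simp add: always_eventually\<close>)
    then show ?case
      by (simp add: LIM_zero_iff)
  qed
  ultimately show ?thesis
    by (rule borel_measurable_lebesgue_on_AE_limit [rotated]) simp
qed

text \<open>Composing the approximating simple functions with \<open>g\<close> keeps them simple;
  \<open>g_diff_le\<close> preserves their convergence and \<open>g_le\<close> gives an integrable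
  majorant. The lemma serves both directions, summation and lift. The norm properties of
  \<open>Y\<close> are separate hypotheses because those of the sum space are obtained through the
  lift and not from an inner product on it.\<close>

lemma L2_compose_contraction:
  assumes f: "f \<in> L2 X"
    and g: "\<And>u. u \<in> carrier X \<Longrightarrow> g u \<in> carrier Y"
    and diff: "\<And>u v. u \<in> carrier Y \<Longrightarrow> v \<in> carrier Y \<Longrightarrow> u - v \<in> carrier Y"
    and nonneg: "\<And>u. u \<in> carrier Y \<Longrightarrow> 0 \<le> nrm Y u"
    and triangle: "\<And>u v. u \<in> carrier Y \<Longrightarrow> v \<in> carrier Y \<Longrightarrow>
      \<bar>nrm Y u - nrm Y v\<bar> \<le> nrm Y (u - v)"
    and g_le: "\<And>u. u \<in> carrier X \<Longrightarrow> nrm Y (g u) \<le> nrm X u"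
    and g_diff_le: "\<And>u v. u \<in> carrier X \<Longrightarrow> v \<in> carrier X \<Longrightarrow>
      nrm Y (g u - g v) \<le> nrm X (u - v)"
  shows "(\<lambda>t. g (f t)) \<in> L2 Y"
proof -
  have mem: "f t \<in> carrier X" if "t \<in> {0..1}" for t
    using f that by (simp add: L2_def)
  have int: "integrable (lebesgue_on {0..1}) (\<lambda>t. (nrm X (f t))\<^sup>2)"
    using f by (simp add: L2_def)
  obtain s where s: "\<And>k::nat. simple_function (lebesgue_on {0..1}) (s k)"
    and s_mem: "\<And>k t. t \<in> {0..1} \<Longrightarrow> s k t \<in> carrier X"
    and lim: "AE t in lebesgue_on {0..1}. (\<lambda>k. nrm X (s k t - f t)) \<longlonglongrightarrow> 0"
    using f unfolding L2_def strongly_measurable_def by blast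
  have "AE t in lebesgue_on {0..1}. (\<lambda>k. nrm Y (g (s k t) - g (f t))) \<longlonglongrightarrow> 0"
    using lim AE_space
  proof eventually_elim
    case (elim t)
    then have t: "t \<in> {0..1}"
      by simp
    show ?case
      by (rule Lim_null_comparison [OF _ elim(1)])
        (use g_diff_le [OF s_mem mem, OF t t] nonneg [OF diff [OF g [OF s_mem] g [OF mem]], OF t t]
          in \<open>simp add: always_eventually\<close>)
  qed
  moreover have "simple_function (lebesgue_on {0..1}) (\<lambda>t. g (s k t))" for k
    using simple_function_compose [OF s, of g] by (simp add: o_def)
  ultimately have sm: "strongly_measurable Y (\<lambda>t. g (f t))"
    unfolding strongly_measurable_def using g s_mem
    by (intro exI [of _ "\<lambda>k t. g (s k t)"]) blast
  have "(\<lambda>t. nrm Y (g (f t))) \<in> borel_measurable (lebesgue_on {0..1})"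
    using sm g mem triangle by (intro strongly_measurable_nrm) auto
  then have "integrable (lebesgue_on {0..1}) (\<lambda>t. (nrm Y (g (f t)))\<^sup>2)"
    by (intro Bochner_Integration.integrable_bound [OF int] AE_I2)
      (auto intro!: power_mono g_le nonneg g mem)
  then show ?thesis
    using sm g mem by (simp add: L2_def)
qed

section \<open>The Hilbert direct sum\<close>

lemma nrm_component_le_direct_sum:
  assumes "i \<in> {1..n}"
  shows "nrm (H i) (u i) \<le> nrm (direct_sum n H) u"
proof -
  have "(nrm (H i) (u i))\<^sup>2 \<le> (\<Sum>i=1..n. (nrm (H i) (u i))\<^sup>2)"
    using assms by (intro member_le_sum) auto
  then show ?thesis
    by (simp add: direct_sum_def real_le_rsqrt)
qed

lemma nrm_direct_sum_power2: "(nrm (direct_sum n H) u)\<^sup>2 = (\<Sum>i=1..n. (nrm (H i) (u i))\<^sup>2)"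
  by (simp add: direct_sum_def sum_nonneg)

text \<open>Inner products add up, and a Cauchy sequence is Cauchy in each component; as there are
  finitely many components, componentwise convergence gives convergence in the norm.\<close>

lemma hilbert_space_direct_sum:
  assumes H: "\<And>i. i \<in> {1..n} \<Longrightarrow> hilbert_space (H i)"
  shows "hilbert_space (direct_sum n H)"
proof -
  have "\<forall>i\<in>{1..n}. \<exists>ip. inner_product_nspace (H i) ip"
    using H hilbert_space_inner_product_nspace by metis
  then obtain ip where "\<And>i. i \<in> {1..n} \<Longrightarrow> inner_product_nspace (H i) (ip i)"
    by metis
  \<comment> \<open>\<open>carrier_closed\<close> contributes four facts, so \<open>ips(6)\<close>,
    \<open>ips(7)\<close> and \<open>ips(9)\<close> are additivity, homogeneity and
    definiteness.\<close>
  note ips = inner_product_nspace.carrier_closed [OF this] inner_product_nspace.ip_commute [OF this]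
    inner_product_nspace.ip_add_left [OF this] inner_product_nspace.ip_scale_left [OF this]
    inner_product_nspace.ip_nonneg [OF this] inner_product_nspace.ip_eq_0 [OF this]
    inner_product_nspace.nrm_power2 [OF this]
  define IP where "IP u v = (\<Sum>i=1..n. ip i (u i) (v i))" for u v
  have "inner_product_on (carrier (direct_sum n H)) IP"
    unfolding inner_product_on_def
  proof (intro conjI ballI allI impI)
    show "subspace (carrier (direct_sum n H))"
      by (auto simp: direct_sum_def subspace_def ips scaleR_fun_def)
    fix u assume "u \<in> carrier (direct_sum n H)"
    then have u: "u i \<in> carrier (H i)" if "i \<in> {1..n}" for i
      using that by (simp add: direct_sum_def)
    show "0 \<le> IP u u"
      unfolding IP_def by (intro sum_nonneg ips u)
    show "u = 0" if "IP u u = 0"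
    proof
      fix i
      show "u i = 0 i"
      proof (cases "i \<in> {1..n}")
        case True
        then have "ip i (u i) (u i) = 0"
          using that unfolding IP_def
          by (subst (asm) sum_nonneg_eq_0_iff) (auto intro!: ips u)
        then show ?thesis
          using ips(9) [OF True u [OF True]] by simp
      next
        case False
        then show ?thesis
          using \<open>u \<in> carrier (direct_sum n H)\<close> by (simp add: direct_sum_def)
      qed
    qed
    fix v assume "v \<in> carrier (direct_sum n H)"
    then have v: "v i \<in> carrier (H i)" if "i \<in> {1..n}" for i
      using that by (simp add: direct_sum_def)
    show "IP u v = IP v u"
      unfolding IP_def by (intro sum.cong ips refl u v)
    show "IP (c *\<^sub>R u) v = c * IP u v" for c
      unfolding IP_def sum_distrib_left by (intro sum.cong) (simp_all add: scaleR_fun_def ips(7) u v)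
    fix w assume "w \<in> carrier (direct_sum n H)"
    then have w: "w i \<in> carrier (H i)" if "i \<in> {1..n}" for i
      using that by (simp add: direct_sum_def)
    show "IP (u + v) w = IP u w + IP v w"
      unfolding IP_def sum.distrib [symmetric] by (intro sum.cong) (simp_all add: ips(6) u v w)
  qed
  moreover have "nrm (direct_sum n H) u = sqrt (IP u u)" if "u \<in> carrier (direct_sum n H)" for u
    using that by (auto simp: direct_sum_def IP_def ips intro!: sum.cong)
  moreover have "\<exists>l\<in>carrier (direct_sum n H). (\<lambda>k. nrm (direct_sum n H) (s k - l)) \<longlonglongrightarrow> 0"
    if s: "\<forall>k. s k \<in> carrier (direct_sum n H)"
      and Cauchy: "\<forall>e>0. \<exists>N. \<forall>j\<ge>N. \<forall>k\<ge>N. nrm (direct_sum n H) (s j - s k) < e"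
    for s :: "nat \<Rightarrow> nat \<Rightarrow> 'a"
  proof -
    have "\<exists>l\<in>carrier (H i). (\<lambda>k. nrm (H i) (s k i - l)) \<longlonglongrightarrow> 0" if i: "i \<in> {1..n}" for i
    proof (rule hilbert_space_complete [OF H [OF i]])
      show "\<forall>k. s k i \<in> carrier (H i)"
        using s i by (simp add: direct_sum_def)
      have "nrm (H i) (s j i - s k i) \<le> nrm (direct_sum n H) (s j - s k)" for j k
        using nrm_component_le_direct_sum [OF i, of H "s j - s k"] by simp
      then show "\<forall>e>0. \<exists>N. \<forall>j\<ge>N. \<forall>k\<ge>N. nrm (H i) (s j i - s k i) < e"
        using Cauchy by (meson le_less_trans)
    qed
    then obtain l where l: "\<And>i. i \<in> {1..n} \<Longrightarrow> l i \<in> carrier (H i)"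
      and lim: "\<And>i. i \<in> {1..n} \<Longrightarrow> (\<lambda>k. nrm (H i) (s k i - l i)) \<longlonglongrightarrow> 0"
      by metis
    \<comment> \<open>The chosen limits are arbitrary outside \<open>{1..n}\<close>, where the
      carrier of the direct sum demands \<open>0\<close>.\<close>
    define l' where "l' i = (if i \<in> {1..n} then l i else 0)" for i
    have "(\<lambda>k. sqrt (\<Sum>i=1..n. (nrm (H i) (s k i - l' i))\<^sup>2)) \<longlonglongrightarrow> sqrt (\<Sum>i=1..n. 0\<^sup>2)"
      by (intro tendsto_intros) (simp add: l'_def lim)
    moreover have "l' \<in> carrier (direct_sum n H)"
      by (simp add: l'_def l direct_sum_def)
    ultimately show ?thesis
      by (intro bexI [of _ l']) (simp_all add: direct_sum_def)
  qed
  ultimately show ?thesis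
    unfolding hilbert_space_def by blast
qed

section \<open>The sum space as a quotient of the direct sum\<close>

lemma carrier_sum_space:
  "carrier (sum_space n H) = (\<lambda>u. \<Sum>i=1..n. u i) ` carrier (direct_sum n H)"
proof -
  have "(\<Sum>i=1..n. u i) \<in> (\<lambda>u. \<Sum>i=1..n. u i) ` carrier (direct_sum n H)"
    if "\<forall>i\<in>{1..n}. u i \<in> carrier (H i)" for u
    using that
    by (intro image_eqI [of _ _ "\<lambda>i. if i \<in> {1..n} then u i else 0"]) (auto simp: direct_sum_def)
  then show ?thesis
    by (auto simp: sum_space_def) (auto simp: direct_sum_def)
qed

text \<open>A preimage of least norm turns the infimum into a minimum. The families in the infimum
  are unrestricted outside \<open>{1..n}\<close>, so they are cut off to \<open>0\<close> there
  before being compared with \<open>p\<close>.\<close>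

lemma nrm_sum_space_eq:
  assumes p: "p \<in> carrier (direct_sum n H)"
    and min: "\<And>u. u \<in> carrier (direct_sum n H) \<Longrightarrow> (\<Sum>i=1..n. u i) = (\<Sum>i=1..n. p i) \<Longrightarrow>
      nrm (direct_sum n H) p \<le> nrm (direct_sum n H) u"
  shows "nrm (sum_space n H) (\<Sum>i=1..n. p i) = nrm (direct_sum n H) p"
proof -
  let ?A = "{(\<Sum>i=1..n. (nrm (H i) (u i))\<^sup>2) | u.
    (\<forall>i\<in>{1..n}. u i \<in> carrier (H i)) \<and> (\<Sum>i=1..n. u i) = (\<Sum>i=1..n. p i)}"
  have "Inf ?A = (\<Sum>i=1..n. (nrm (H i) (p i))\<^sup>2)"
  proof (rule cInf_eq_minimum)
    show "(\<Sum>i=1..n. (nrm (H i) (p i))\<^sup>2) \<in> ?A"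
      using p by (auto simp: direct_sum_def)
  next
    fix r assume "r \<in> ?A"
    then obtain u where r: "r = (\<Sum>i=1..n. (nrm (H i) (u i))\<^sup>2)"
      and u: "\<forall>i\<in>{1..n}. u i \<in> carrier (H i)" "(\<Sum>i=1..n. u i) = (\<Sum>i=1..n. p i)"
      by blast
    define u' where "u' i = (if i \<in> {1..n} then u i else 0)" for i
    have "nrm (direct_sum n H) p \<le> nrm (direct_sum n H) u'"
      using u by (intro min) (auto simp: u'_def direct_sum_def)
    then show "(\<Sum>i=1..n. (nrm (H i) (p i))\<^sup>2) \<le> r"
      by (simp add: direct_sum_def r u'_def)
  qed
  then show ?thesis
    by (simp add: sum_space_def direct_sum_def)
qed

lemma linear_sum_components: "linear (\<lambda>u::nat \<Rightarrow> 'x::real_vector. \<Sum>i\<in>I. u i)"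
  by (rule linearI) (simp_all add: sum.distrib scaleR_fun_def scaleR_sum_right)

lemma sum_fun_apply: "(\<Sum>i\<in>I. f i) x = (\<Sum>i\<in>I. f i x)"
  by (induction I rule: infinite_finite_induct) auto

text \<open>Continuity of the point evaluations makes the kernel of the summation map closed.\<close>

lemma sum_space_isometric_lift:
  fixes H :: "nat \<Rightarrow> ('a \<Rightarrow> 'b::real_normed_vector) nspace"
  assumes H: "\<And>i. i \<in> {1..n} \<Longrightarrow> hilbert_space (H i)"
    and eval: "\<And>i x. i \<in> {1..n} \<Longrightarrow> \<exists>M. \<forall>v\<in>carrier (H i). norm (v x) \<le> M * nrm (H i) v"
  obtains P where
    "\<And>v. v \<in> carrier (sum_space n H) \<Longrightarrow> P v \<in> carrier (direct_sum n H)"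
    "\<And>v. v \<in> carrier (sum_space n H) \<Longrightarrow> (\<Sum>i=1..n. P v i) = v"
    "\<And>v. v \<in> carrier (sum_space n H) \<Longrightarrow> nrm (direct_sum n H) (P v) = nrm (sum_space n H) v"
    "\<And>v w. v \<in> carrier (sum_space n H) \<Longrightarrow> w \<in> carrier (sum_space n H) \<Longrightarrow> P (v - w) = P v - P w"
    "\<And>u. u \<in> carrier (direct_sum n H) \<Longrightarrow>
      nrm (sum_space n H) (\<Sum>i=1..n. u i) \<le> nrm (direct_sum n H) u"
proof -
  define X where "X = direct_sum n H"
  have X: "hilbert_space X"
    unfolding X_def by (rule hilbert_space_direct_sum [OF H])
  then obtain ip where "inner_product_nspace X ip"
    using hilbert_space_inner_product_nspace by blast
  then interpret inner_product_nspace X ip .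
  define S where "S u = (\<Sum>i=1..n. u i)" for u :: "nat \<Rightarrow> 'a \<Rightarrow> 'b"
  have "linear S"
    unfolding S_def by (rule linear_sum_components)
  have closed: "S l = 0"
    if s: "\<forall>k::nat. s k \<in> carrier X \<and> S (s k) = 0" and l: "l \<in> carrier X"
      and lim: "(\<lambda>k. nrm X (s k - l)) \<longlonglongrightarrow> 0" for s l
  proof
    fix x
    have "(\<lambda>k. s k i x - l i x) \<longlonglongrightarrow> 0" if i: "i \<in> {1..n}" for i
    proof -
      obtain M where M: "\<And>v. v \<in> carrier (H i) \<Longrightarrow> norm (v x) \<le> M * nrm (H i) v"
        using eval [OF i] by blast
      \<comment> \<open>The constant \<open>M\<close> comes without a sign, hence the absolute
        value.\<close>
      have le: "norm (s k i x - l i x) \<le> \<bar>M\<bar> * nrm X (s k - l)" for k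
      proof -
        have "s k - l \<in> carrier X"
          using s l by simp
        then have mem: "s k i - l i \<in> carrier (H i)"
          using i by (simp add: X_def direct_sum_def)
        obtain ip\<^sub>i where "inner_product_nspace (H i) ip\<^sub>i"
          using hilbert_space_inner_product_nspace [OF H [OF i]] .
        then have nonneg: "0 \<le> nrm (H i) (s k i - l i)"
          using mem by (rule inner_product_nspace.nrm_nonneg)
        have "norm ((s k i - l i) x) \<le> M * nrm (H i) (s k i - l i)"
          by (rule M [OF mem])
        also have "\<dots> \<le> \<bar>M\<bar> * nrm (H i) (s k i - l i)"
          using nonneg by (intro mult_right_mono) auto
        also have "\<dots> \<le> \<bar>M\<bar> * nrm X (s k - l)"
          using nrm_component_le_direct_sum [OF i, of H "s k - l"]
          by (intro mult_left_mono) (simp_all add: X_def)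
        finally show ?thesis
          by simp
      qed
      have "(\<lambda>k. \<bar>M\<bar> * nrm X (s k - l)) \<longlonglongrightarrow> 0"
        using tendsto_mult_left [OF lim, of "\<bar>M\<bar>"] by simp
      then show ?thesis
        by (rule Lim_null_comparison [rotated]) (simp add: le)
    qed
    then have "(\<lambda>k. \<Sum>i=1..n. s k i x - l i x) \<longlonglongrightarrow> (\<Sum>i=1..n. 0)"
      by (intro tendsto_sum) simp
    \<comment> \<open>Since every \<open>s k\<close> is in the kernel, the sequence is constant in
      \<open>k\<close>; its limit \<open>0\<close> is therefore its value.\<close>
    moreover have "(\<Sum>i=1..n. s k i x - l i x) = - S l x" for k
    proof -
      have "S (s k) x = 0"
        using s by simp
      then show ?thesis
        by (simp add: S_def sum_fun_apply sum_subtractf)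
    qed
    ultimately show "S l x = 0 x"
      by (simp add: tendsto_const_iff)
  qed
  have carrier: "carrier (sum_space n H) = S ` carrier X"
    by (simp add: carrier_sum_space X_def S_def [abs_def])
  obtain P where P: "\<And>v. v \<in> S ` carrier X \<Longrightarrow> P v \<in> carrier X"
    "\<And>v. v \<in> S ` carrier X \<Longrightarrow> S (P v) = v"
    "\<And>u. u \<in> carrier X \<Longrightarrow> nrm X (P (S u)) \<le> nrm X u"
    "\<And>v w. v \<in> S ` carrier X \<Longrightarrow> w \<in> S ` carrier X \<Longrightarrow> P (v - w) = P v - P w"
    by (rule minimal_norm_lift [OF X \<open>linear S\<close>]) (use closed in blast)+
  have nrm_P: "nrm X (P v) = nrm (sum_space n H) v" if "v \<in> S ` carrier X" for v
  proof -
    have "nrm (sum_space n H) (S (P v)) = nrm X (P v)"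
      unfolding S_def X_def
    proof (rule nrm_sum_space_eq)
      show "P v \<in> carrier (direct_sum n H)"
        using P(1) [OF that] by (simp add: X_def)
      show "nrm (direct_sum n H) (P v) \<le> nrm (direct_sum n H) u"
        if "u \<in> carrier (direct_sum n H)" "(\<Sum>i=1..n. u i) = (\<Sum>i=1..n. P v i)" for u
        using P(3) [of u] P(2) [OF \<open>v \<in> S ` carrier X\<close>] that by (simp add: X_def S_def)
    qed
    then show ?thesis
      by (simp add: P(2) that)
  qed
  show thesis
  proof (rule that [of P])
    \<comment> \<open>Summation is a contraction: the norm of \<open>S u\<close> is that of its
      lift, the smallest among all preimages, \<open>u\<close> included.\<close>
    show "nrm (sum_space n H) (\<Sum>i=1..n. u i) \<le> nrm (direct_sum n H) u"
      if "u \<in> carrier (direct_sum n H)" for u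
      using P(3) [of u] nrm_P [of "S u"] that by (simp add: X_def S_def)
  qed (use P nrm_P in \<open>simp_all only: carrier flip: X_def S_def\<close>)
qed

section \<open>Point evaluations, flows and infima\<close>

lemma admissible_point_evaluation:
  assumes "admissible \<Omega> H"
  shows "\<exists>M. \<forall>v\<in>carrier H. norm (v x) \<le> M * nrm H v"
proof -
  obtain M where "M > 0" and M: "\<And>v. v \<in> carrier H \<Longrightarrow> norm_1_inf \<Omega> v \<le> ennreal (M * nrm H v)"
    using assms unfolding admissible_def by blast
  obtain ip where "inner_product_nspace H ip"
    using assms hilbert_space_inner_product_nspace unfolding admissible_def by blast
  then interpret inner_product_nspace H ip .
  have "norm (v x) \<le> M * nrm H v" if v: "v \<in> carrier H" for v
  proof (cases "x \<in> \<Omega>")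
    case True
    then have "ennreal (norm (v x)) \<le> norm_1_inf \<Omega> v"
      unfolding norm_1_inf_def by (intro add_increasing2 SUP_upper) auto
    also have "\<dots> \<le> ennreal (M * nrm H v)"
      by (rule M [OF v])
    finally show ?thesis
      using nrm_nonneg [OF v] \<open>M > 0\<close> by simp
  next
    case False
    then have "v x = 0"
      using assms v by (simp add: admissible_def vanishes_at_boundary_def)
    then show ?thesis
      using nrm_nonneg [OF v] \<open>M > 0\<close> by simp
  qed
  then show ?thesis
    by blast
qed

text \<open>\<open>is_flow\<close> tests the field only at times in \<open>{0..1}\<close>, so both
  fields satisfy the same predicate and \<open>SOME\<close> returns the same flow.\<close>

lemma flow_cong:
  fixes v w :: "real \<Rightarrow> 'a::finite vfield"
  assumes "\<And>t. t \<in> {0..1} \<Longrightarrow> v t = w t"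
  shows "flow v = flow w"
proof -
  have "((\<lambda>s. v s (\<phi> s x)) has_integral y) {0..t} \<longleftrightarrow> ((\<lambda>s. w s (\<phi> s x)) has_integral y) {0..t}"
    if "t \<in> {0..1}" for \<phi> :: "real \<Rightarrow> 'a vfield" and x y t
    using that assms by (intro has_integral_cong) auto
  then have "is_flow v \<phi> \<longleftrightarrow> is_flow w \<phi>" for \<phi>
    by (simp only: is_flow_def cong: ball_cong)
  then show ?thesis
    by (simp only: flow_def)
qed

text \<open>Each domination bounds one infimum by the other. Monotonicity needs nonempty index sets,
  and by the dominations either both are empty or neither is.\<close>

lemma cINF_eq_of_dominating:
  fixes f :: "'a \<Rightarrow> 'c::conditionally_complete_lattice" and g :: "'b \<Rightarrow> 'c"
  assumes "bdd_below (f ` A)" "bdd_below (g ` B)"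
    and "\<And>a. a \<in> A \<Longrightarrow> \<exists>b\<in>B. g b \<le> f a"
    and "\<And>b. b \<in> B \<Longrightarrow> \<exists>a\<in>A. f a \<le> g b"
  shows "(INF a\<in>A. f a) = (INF b\<in>B. g b)"
proof (cases "A = {}")
  case True
  then have "B = {}"
    using assms(4) by blast
  with True show ?thesis
    by simp
next
  case False
  then have "B \<noteq> {}"
    using assms(3) by blast
  with False show ?thesis
    using assms by (intro antisym cINF_mono) auto
qed

theorem proposition2p3:
  fixes \<Omega> :: "(real ^ 'd::finite) set"
    and n :: nat
    and Hs :: "nat \<Rightarrow> 'd vfield nspace"
    and Q :: "'q set"
    and d :: "'q \<Rightarrow> 'q \<Rightarrow> real"
    and act :: "'d vfield \<Rightarrow> 'q \<Rightarrow> 'q"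
    and I0 Itarget :: 'q
  defines "H \<equiv> sum_space n Hs"
    and "\<E> \<equiv> energy_E n Hs act d I0 Itarget"
    and "\<F> \<equiv> energy_F (sum_space n Hs) act d I0 Itarget"
  assumes "open \<Omega>" "connected \<Omega>" "\<Omega> \<noteq> {}"
    and "n \<ge> 1"
    and "\<And>i. i \<in> {1..n} \<Longrightarrow> admissible \<Omega> (Hs i)"
    and "Metric_space Q d"
    and "group_action (diffeo_group H) Q act"
    and "I0 \<in> Q" "Itarget \<in> Q"
  shows
    \<comment> \<open>summation maps \<open>L\<^sup>2(\<Oplus> H\<^sub>i)\<close> into \<open>L\<^sup>2(H)\<close> and does not increase the energy\<close>
    "(\<forall>v \<in> L2 (direct_sum n Hs).
        (\<lambda>t. \<Sum>i=1..n. v t i) \<in> L2 H \<and> \<F> (\<lambda>t. \<Sum>i=1..n. v t i) \<le> \<E> v) \<and>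
    \<comment> \<open>every \<open>w\<close> in \<open>L\<^sup>2(H)\<close> is such a sum with equal energy\<close>
     (\<forall>w \<in> L2 H. \<exists>v \<in> L2 (direct_sum n Hs).
        (\<forall>t\<in>{0..1}. (\<Sum>i=1..n. v t i) = w t) \<and> \<E> v = \<F> w) \<and>
    \<comment> \<open>hence the infima agree and minimisers correspond\<close>
     (INF v \<in> L2 (direct_sum n Hs). \<E> v) = (INF w \<in> L2 H. \<F> w) \<and>
     (\<forall>v. is_arg_min \<E> (\<lambda>v. v \<in> L2 (direct_sum n Hs)) v \<longrightarrow>
          is_arg_min \<F> (\<lambda>w. w \<in> L2 H) (\<lambda>t. \<Sum>i=1..n. v t i)) \<and>
     (\<forall>w. is_arg_min \<F> (\<lambda>w. w \<in> L2 H) w \<longrightarrow>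
          (\<exists>v. is_arg_min \<E> (\<lambda>v. v \<in> L2 (direct_sum n Hs)) v \<and>
               (\<forall>t\<in>{0..1}. (\<Sum>i=1..n. v t i) = w t)))"
proof -
  define X where "X = direct_sum n Hs"
  have hilbert: "hilbert_space (Hs i)" if "i \<in> {1..n}" for i
    using assms(8) [OF that] by (simp add: admissible_def)
  have "hilbert_space X"
    unfolding X_def by (rule hilbert_space_direct_sum [OF hilbert])
  then obtain ip where "inner_product_nspace X ip"
    using hilbert_space_inner_product_nspace by blast
  then interpret X: inner_product_nspace X ip .
  define S where "S u = (\<Sum>i=1..n. u i)" for u :: "nat \<Rightarrow> 'd vfield"
  have S: "linear S"
    unfolding S_def by (rule linear_sum_components)
  have carrier_H: "carrier H = S ` carrier X"
    by (simp add: H_def carrier_sum_space X_def S_def [abs_def])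
  obtain P where P: "\<And>v. v \<in> carrier H \<Longrightarrow> P v \<in> carrier X"
    "\<And>v. v \<in> carrier H \<Longrightarrow> S (P v) = v"
    "\<And>v. v \<in> carrier H \<Longrightarrow> nrm X (P v) = nrm H v"
    "\<And>v w. v \<in> carrier H \<Longrightarrow> w \<in> carrier H \<Longrightarrow> P (v - w) = P v - P w"
    and S_le: "\<And>u. u \<in> carrier X \<Longrightarrow> nrm H (S u) \<le> nrm X u"
    unfolding H_def X_def S_def
    by (rule sum_space_isometric_lift [OF hilbert admissible_point_evaluation [OF assms(8)]]) blast+
  have diff_H: "v - w \<in> carrier H" if "v \<in> carrier H" "w \<in> carrier H" for v w
    using subspace_diff [OF linear_subspace_image [OF S X.subspace_carrier]] that
    by (simp add: carrier_H)
  \<comment> \<open>\<open>P\<close> is additive and isometric, so the inequality for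
    \<open>P v\<close> and \<open>P w\<close> in \<open>X\<close> is the one for \<open>v\<close>
    and \<open>w\<close> in \<open>H\<close>.\<close>
  have triangle_H: "\<bar>nrm H v - nrm H w\<bar> \<le> nrm H (v - w)"
    if "v \<in> carrier H" "w \<in> carrier H" for v w
    using X.nrm_triangle_reverse [of "P v" "P w"] that P diff_H by (metis P(3,4))
  have nonneg_H: "0 \<le> nrm H v" if "v \<in> carrier H" for v
    using X.nrm_nonneg [OF P(1) [OF that]] P(3) [OF that] by simp
  have E: "\<E> v = 1/2 * (LINT t|lebesgue_on {0..1}. (nrm X (v t))\<^sup>2) +
      (d (act (flow (\<lambda>t. S (v t)) 1) I0) Itarget)\<^sup>2" for v
    by (simp add: \<E>_def energy_E_def X_def nrm_direct_sum_power2 S_def)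
  have F: "\<F> w = 1/2 * (LINT t|lebesgue_on {0..1}. (nrm H (w t))\<^sup>2) +
      (d (act (flow w 1) I0) Itarget)\<^sup>2" for w
    by (simp add: \<F>_def energy_F_def H_def)
  have sum: "(\<lambda>t. S (v t)) \<in> L2 H \<and> \<F> (\<lambda>t. S (v t)) \<le> \<E> v" if v: "v \<in> L2 X" for v
  proof
    show L2: "(\<lambda>t. S (v t)) \<in> L2 H"
      by (rule L2_compose_contraction [OF v])
        (auto simp: carrier_H intro: diff_H [unfolded carrier_H] nonneg_H [unfolded carrier_H]
          triangle_H [unfolded carrier_H] S_le simp flip: linear_diff [OF S])
    have "v t \<in> carrier X" if "t \<in> {0..1}" for t
      using v that by (simp add: L2_def)
    then have "(LINT t|lebesgue_on {0..1}. (nrm H (S (v t)))\<^sup>2)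
        \<le> (LINT t|lebesgue_on {0..1}. (nrm X (v t))\<^sup>2)"
      using v L2 by (intro integral_mono) (auto simp: L2_def carrier_H intro!: power_mono S_le nonneg_H)
    then show "\<F> (\<lambda>t. S (v t)) \<le> \<E> v"
      by (simp add: E F)
  qed
  have split: "\<exists>v\<in>L2 X. (\<forall>t\<in>{0..1}. S (v t) = w t) \<and> \<E> v = \<F> w" if w: "w \<in> L2 H" for w
  proof (intro bexI conjI)
    have mem: "w t \<in> carrier H" if "t \<in> {0..1}" for t
      using w that by (simp add: L2_def)
    show "(\<lambda>t. P (w t)) \<in> L2 X"
      by (rule L2_compose_contraction [OF w])
        (simp_all add: P X.nrm_nonneg X.nrm_triangle_reverse diff_H flip: P(4))
    show SP: "\<forall>t\<in>{0..1}. S (P (w t)) = w t"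
      using mem P(2) by blast
    \<comment> \<open>Outside \<open>{0..1}\<close> the value \<open>w t\<close> may leave
      \<open>H\<close>, where \<open>P\<close> is unspecified; the two fields agree only on
      \<open>{0..1}\<close>.\<close>
    then have "flow (\<lambda>t. S (P (w t))) = flow w"
      by (intro flow_cong) blast
    moreover have "(LINT t|lebesgue_on {0..1}. (nrm X (P (w t)))\<^sup>2)
        = (LINT t|lebesgue_on {0..1}. (nrm H (w t))\<^sup>2)"
      using mem P(3) by (intro Bochner_Integration.integral_cong) auto
    ultimately show "\<E> (\<lambda>t. P (w t)) = \<F> w"
      by (simp add: E F)
  qed
  have "bdd_below (\<E> ` L2 X)" "bdd_below (\<F> ` L2 H)"
    by (auto intro!: bdd_belowI [of _ 0] simp: E F)
  then have "(INF v\<in>L2 X. \<E> v) = (INF w\<in>L2 H. \<F> w)"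
    using sum split by (intro cINF_eq_of_dominating) (blast, blast, blast, metis order_refl)
  moreover have "is_arg_min \<F> (\<lambda>w. w \<in> L2 H) (\<lambda>t. S (v t))"
    if v: "is_arg_min \<E> (\<lambda>v. v \<in> L2 X) v" for v
    unfolding is_arg_min_linorder
  proof (intro conjI allI impI)
    show "(\<lambda>t. S (v t)) \<in> L2 H"
      using v sum by (simp add: is_arg_min_linorder)
    fix w assume "w \<in> L2 H"
    then obtain u where "u \<in> L2 X" "\<E> u = \<F> w"
      using split by blast
    then show "\<F> (\<lambda>t. S (v t)) \<le> \<F> w"
      using v sum [of v] by (force simp: is_arg_min_linorder)
  qed
  moreover have "\<exists>v. is_arg_min \<E> (\<lambda>v. v \<in> L2 X) v \<and> (\<forall>t\<in>{0..1}. S (v t) = w t)"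
    if w: "is_arg_min \<F> (\<lambda>w. w \<in> L2 H) w" for w
  proof -
    obtain v where v: "v \<in> L2 X" "\<forall>t\<in>{0..1}. S (v t) = w t" "\<E> v = \<F> w"
      using split [of w] w by (auto simp: is_arg_min_linorder)
    \<comment> \<open>The chain is \<open>\<E> v = \<F> w\<close>, then minimality of
      \<open>w\<close> against the sum of \<open>u\<close>, then the fact that summation does not
      raise the energy.\<close>
    have "\<E> v \<le> \<E> u" if "u \<in> L2 X" for u
      using w sum [OF that] v(3) by (force simp: is_arg_min_linorder)
    with v show ?thesis
      by (auto simp: is_arg_min_linorder)
  qed
  ultimately show ?thesis
    using sum split unfolding X_def S_def by blast
qed

end
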